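(* Let $V$, $W$ be subgroups of $\mathcal{L}_n$ with triples $(s,V_0,v)$ and $(t,W_0,w)$, and let $U=V\cap W$. Let $r>0$ be the minimal positive integer such that both $s$ and $t$ divide $r$ and $$\frac{1-x^r}{1-x^s}v\equiv\frac{1-x^r}{1-x^t}w \pmod{V_0+W_0},$$ and if no such number exists put $r=0$. If $r=0$, then $V\cap W=V_0\cap W_0\subset\mathcal{A}_n$; in particular $V\cap W$ is trivial if $r=0$ and $V_0\cap W_0=\{0\}$. If $r>0$, then there exist $v_0\in V_0$ and $w_0\in W_0$ such that $$\frac{1-x^r}{1-x^s}v+v_0=\frac{1-x^r}{1-x^t}w+w_0 .$$ Denoting this element by $u$, the triple $(r,V_0\cap W_0,u)$ is the triple of the subgroup $U$.
   Context: $p$ is a fixed prime, $n\ge 1$, $R=\mathbb{F}_p[x,x^{-1}]$, and $\mathbb{N}$ contains $0$. $\mathcal{A}_n=\bigoplus_{\mathbb{Z}}(\mathbb{Z}/p\mathbb{Z})^n$ is identified with the additive group of $R^n$, so that the shift by one on $\mathcal{A}_n$ is multiplication by $x$. $\mathcal{L}_n=(\mathbb{Z}/p\mathbb{Z})^n\wr\mathbb{Z}=\mathcal{A}_n\rtimes\mathbb{Z}$, with elements written $(v,s)$ and multiplication $(v,s)(w,t)=(v+x^sw,s+t)$; $\mathcal{A}_n$ is identified with $\{(v,0)\}$. The triple $(s,V_0,v)$ of a subgroup $V\le\mathcal{L}_n$: $s\in\mathbb{N}$ is such that $s\mathbb{Z}$ is the image of $V$ under the projection to $\mathbb{Z}$,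 $V_0=V\cap\mathcal{A}_n$ (it satisfies $x^sV_0=V_0$), and $v\in\mathcal{A}_n$ is any element with $(v,s)\in V$ (well defined modulo $V_0$; for $s=0$ one takes $v=0$). A positive integer is not divisible by $0$, so $r=0$ whenever $s=0$ or $t=0$. For $s\mid r$ with $s,r>0$, $\frac{1-x^r}{1-x^s}=1+x^s+\dots+x^{r-s}\in R$. *)

theory Defs
  imports
    "HOL-Analysis.Finite_Cartesian_Product"
    "HOL-Algebra.Group"
    "HOL-Library.Poly_Mapping"
    "HOL-Library.Set_Algebras"
    "Berlekamp_Zassenhaus.Finite_Field"
begin

text \<open>
  The prime is \<open>p = CARD('p)\<close> for a type \<open>'p\<close> of class \<open>prime_card\<close>, and \<open>n = CARD('n)\<close>.
  Finitely supported functions \<open>int \<Rightarrow>\<^sub>0 'p mod_ring\<close> carry the convolution product, which makes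
  them the ring of Laurent polynomials over the field with \<open>p\<close> elements.
\<close>

type_synonym 'p laurent = "int \<Rightarrow>\<^sub>0 'p mod_ring"

type_synonym ('p, 'n) base = "'p laurent ^ 'n"

definition X_pow :: "int \<Rightarrow> 'p::prime_card laurent" where
  "X_pow k = Poly_Mapping.single k 1"

lemma X_pow_0: "X_pow 0 = 1"
  by (simp add: X_pow_def)

lemma X_pow_add: "X_pow (j + k) = X_pow j * X_pow k"
  by (simp add: X_pow_def mult_single)

lemma X_pow_of_nat: "X_pow (int k) = X_pow 1 ^ k"
  by (induction k) (simp_all add: X_pow_0 X_pow_add)

definition lamplighter :: "(('p::prime_card, 'n::finite) base \<times> int) monoid" where
  "lamplighter = \<lparr>carrier = UNIV,
     monoid.mult = (\<lambda>(v, s) (w, t). (v + X_pow s *s w, s + t)),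
     one = (0, 0)\<rparr>"

lemma group_lamplighter:
  "group (lamplighter :: (('p::prime_card, 'n::finite) base \<times> int) monoid)"
proof (rule groupI)
  fix a :: "('p, 'n) base \<times> int"
  obtain v s where a: "a = (v, s)" by (cases a)
  have "X_pow (- s) *s v + X_pow (- s) *s (- v) = 0"
    by (simp add: vec_eq_iff)
  then have "(X_pow (- s) *s (- v), - s) \<otimes>\<^bsub>lamplighter\<^esub> a = \<one>\<^bsub>lamplighter\<^esub>"
    by (simp add: lamplighter_def a vec_eq_iff)
  then show "\<exists>b\<in>carrier lamplighter. b \<otimes>\<^bsub>lamplighter\<^esub> a = \<one>\<^bsub>lamplighter\<^esub>"
    by (rule bexI) (simp add: lamplighter_def)
qed (auto simp: lamplighter_def X_pow_0 X_pow_add vec_eq_iff algebra_simps)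

text \<open>The copy of the base group inside the lamplighter group; \<open>V \<inter> range base_emb\<close> is
  \<open>base_emb ` base_part V\<close>.\<close>

definition base_emb :: "('p::prime_card, 'n::finite) base \<Rightarrow> ('p, 'n) base \<times> int" where
  "base_emb a = (a, 0)"

definition base_part :: "(('p::prime_card, 'n::finite) base \<times> int) set \<Rightarrow> ('p, 'n) base set" where
  "base_part V = {a. base_emb a \<in> V}"

lemma base_emb_image_base_part: "base_emb ` base_part V = V \<inter> range base_emb"
  by (auto simp: base_part_def)

definition is_triple ::
  "(('p::prime_card, 'n::finite) base \<times> int) set \<Rightarrow> nat \<times> ('p, 'n) base set \<times> ('p, 'n) base \<Rightarrow> bool"
where
  "is_triple V = (\<lambda>(s, V\<^sub>0, v).
     snd ` V = {k. int s dvd k} \<and> V\<^sub>0 = base_part V \<and> (v, int s) \<in> V \<and> (s = 0 \<longrightarrow> v = 0))"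

text \<open>The quotient \<open>(1 - x^r) / (1 - x^s)\<close>, used only for \<open>r, s > 0\<close> with \<open>s\<close> dividing \<open>r\<close>.\<close>

definition geom_quot :: "nat \<Rightarrow> nat \<Rightarrow> 'p::prime_card laurent" where
  "geom_quot r s = (\<Sum>i<r div s. X_pow (int (i * s)))"

lemma geom_quot_mult:
  assumes "s dvd r"
  shows "geom_quot r s * (1 - X_pow (int s) :: 'p::prime_card laurent) = 1 - X_pow (int r)"
proof (cases "s = 0")
  case True
  with assms show ?thesis by (simp add: X_pow_0)
next
  case False
  from assms obtain k where "r = s * k" ..
  have "X_pow (int (i * s)) = (X_pow (int s) :: 'p laurent) ^ i" for i
    by (induction i) (simp_all add: X_pow_0 X_pow_add)
  with False \<open>r = s * k\<close> show ?thesis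
    by (simp add: geom_quot_def one_diff_power_eq mult.commute)
qed

definition common_level ::
  "nat \<times> ('p, 'n) base set \<times> ('p::prime_card, 'n::finite) base
     \<Rightarrow> nat \<times> ('p, 'n) base set \<times> ('p, 'n) base \<Rightarrow> nat \<Rightarrow> bool"
where
  "common_level = (\<lambda>(s, V\<^sub>0, v) (t, W\<^sub>0, w) r.
     0 < r \<and> s dvd r \<and> t dvd r \<and> geom_quot r s *s v - geom_quot r t *s w \<in> V\<^sub>0 + W\<^sub>0)"

definition min_common_level ::
  "nat \<times> ('p, 'n) base set \<times> ('p::prime_card, 'n::finite) base
     \<Rightarrow> nat \<times> ('p, 'n) base set \<times> ('p, 'n) base \<Rightarrow> nat"
where
  "min_common_level T T' =
     (if \<exists>r. common_level T T' r then LEAST r. common_level T T' r else 0)"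

end

theory Submission
  imports Defs
begin

text \<open>Above a positive level \<open>r\<close> divisible by \<open>s\<close>, the subgroup \<open>V\<close> contains the power
  \<open>(v, s)\<^bsup>r/s\<^esup>\<close>, whose base component is \<open>(1 - x\<^sup>r)/(1 - x\<^sup>s) v\<close>, so its fibre over \<open>r\<close> is the
  coset of \<open>V\<^sub>0\<close> through that element. Two cosets of \<open>V\<^sub>0\<close> and \<open>W\<^sub>0\<close> meet iff their representatives
  agree modulo \<open>V\<^sub>0 + W\<^sub>0\<close>; hence the common levels are exactly the positive elements of the
  projection of \<open>V \<inter> W\<close> to the integers, and this projection is generated by the least one.\<close>

lemma lamplighter_mult_closed:
  assumes "subgroup V lamplighter" "(a, j) \<in> V" "(b, k) \<in> V"
  shows "(a + X_pow j *s b, j + k) \<in> V"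
  using subgroup.m_closed[OF assms] by (simp add: lamplighter_def)

lemma lamplighter_one_closed:
  assumes "subgroup V lamplighter"
  shows "(0, 0) \<in> V"
  using subgroup.one_closed[OF assms] by (simp add: lamplighter_def)

lemma lamplighter_inv_closed:
  assumes "subgroup V lamplighter" "(a, k) \<in> V"
  shows "(- (X_pow (- k) *s a), - k) \<in> V"
proof -
  have "X_pow (- k) *s a + - (X_pow (- k) *s a) = 0"
    by simp
  then have "inv\<^bsub>lamplighter\<^esub> (a, k) = (- (X_pow (- k) *s a), - k)"
    by (intro group.inv_equality[OF group_lamplighter])
      (simp_all add: lamplighter_def)
  with subgroup.m_inv_closed[OF assms] show ?thesis by simp
qed

lemma base_part_minus:
  assumes "subgroup V lamplighter" "a \<in> base_part V"
  shows "- a \<in> base_part V"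
  using lamplighter_inv_closed[OF assms(1), of a 0] assms(2)
  by (simp add: base_part_def base_emb_def X_pow_0)

lemma base_part_Int: "base_part (V \<inter> W) = base_part V \<inter> base_part W"
  by (auto simp: base_part_def)

lemma geom_quot_mult_Suc:
  assumes "0 < s"
  shows "geom_quot (Suc k * s) s = geom_quot (k * s) s + X_pow (int (k * s))"
proof -
  have "Suc k * s div s = Suc k" "k * s div s = k"
    using assms by (simp_all only: nonzero_mult_div_cancel_right)
  then show ?thesis
    by (simp only: geom_quot_def sum.lessThan_Suc)
qed

text \<open>Induction over the powers of \<open>(v, s)\<close>: multiplying the \<open>k\<close>-th
  power on the right by \<open>(v, s)\<close> shifts \<open>v\<close> by
  \<open>X_pow (k * s)\<close>, which is the next summand of the geometric sum.\<close>

lemma lamplighter_geom_quot_mem: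
  assumes "subgroup V lamplighter" "(v, int s) \<in> V" "0 < s" "s dvd r"
  shows "(geom_quot r s *s v, int r) \<in> V"
proof -
  have "(geom_quot (k * s) s *s v, int (k * s)) \<in> V" for k
  proof (induction k)
    case 0
    with lamplighter_one_closed[OF assms(1)] show ?case
      by (simp add: geom_quot_def)
  next
    case (Suc k)
    have "geom_quot (Suc k * s) s *s v = geom_quot (k * s) s *s v + X_pow (int (k * s)) *s v"
      using assms(3) by (simp only: geom_quot_mult_Suc vector_sadd_rdistrib)
    moreover have "int (Suc k * s) = int (k * s) + int s"
      by simp
    ultimately show ?case
      using lamplighter_mult_closed[OF assms(1) Suc assms(2)] by (simp only:)
  qed
  with assms(4) show ?thesis
    by (metis dvdE mult.commute)
qed

text \<open>Multiplying \<open>(a, k)\<close> on the right by the inverse of \<open>(g, k)\<close>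
  lands in level 0, and there the two opposite shifts applied to \<open>g\<close> cancel.
  Conversely, \<open>(a - g, 0)\<close> multiplies \<open>(g, k)\<close> from the left without any
  shift.\<close>

lemma fibre_diff_iff:
  assumes "subgroup V lamplighter" "(g, k) \<in> V"
  shows "(a, k) \<in> V \<longleftrightarrow> a - g \<in> base_part V"
proof
  assume "(a, k) \<in> V"
  from lamplighter_mult_closed[OF assms(1) this lamplighter_inv_closed[OF assms]]
  have "(a + X_pow k *s - (X_pow (- k) *s g), 0) \<in> V"
    by simp
  moreover have "X_pow k * (X_pow (- k) * y) = y" for y :: "'a laurent"
    by (simp add: mult.assoc[symmetric] X_pow_add[symmetric] X_pow_0)
  then have "X_pow k *s - (X_pow (- k) *s g) = - g"
    by (simp add: vec_eq_iff)
  ultimately show "a - g \<in> base_part V"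
    by (simp add: base_part_def base_emb_def)
next
  assume "a - g \<in> base_part V"
  then have "(a - g, 0) \<in> V"
    by (simp add: base_part_def base_emb_def)
  from lamplighter_mult_closed[OF assms(1) this assms(2)] show "(a, k) \<in> V"
    by (simp add: X_pow_0)
qed

lemma triple_level_dvd:
  assumes "is_triple V (s, V\<^sub>0, v)" "(a, int r) \<in> V"
  shows "s dvd r"
proof -
  from assms(2) have "int r \<in> snd ` V" by force
  with assms(1) show ?thesis by (simp add: is_triple_def)
qed

text \<open>Since 0 divides no positive \<open>r\<close>, divisibility forces \<open>0 < s\<close>,
  so \<open>geom_quot r s\<close> is a genuine geometric sum and gives a base point of the fibre
  over \<open>r\<close>. Without divisibility the fibre is empty.\<close>

lemma triple_fibre_iff:
  assumes "subgroup V lamplighter" "is_triple V (s, V\<^sub>0, v)" "0 < r"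
  shows "(a, int r) \<in> V \<longleftrightarrow> s dvd r \<and> a - geom_quot r s *s v \<in> V\<^sub>0"
proof (cases "s dvd r")
  case True
  with \<open>0 < r\<close> have "0 < s" by (metis dvd_0_left gr0I not_less0)
  with True assms have "(geom_quot r s *s v, int r) \<in> V"
    by (intro lamplighter_geom_quot_mem) (simp_all add: is_triple_def)
  from fibre_diff_iff[OF assms(1) this] True assms(2) show ?thesis
    by (simp add: is_triple_def)
next
  case False
  with triple_level_dvd[OF assms(2)] show ?thesis by blast
qed

text \<open>This translates the arithmetic congruence into group theory, so that minimality of
  \<open>r\<close> becomes a statement about the projection of the intersection to the
  integers.\<close>

lemma common_level_iff:
  assumes V: "subgroup V lamplighter" "is_triple V (s, V\<^sub>0, v)"
    and W: "subgroup W lamplighter" "is_triple W (t, W\<^sub>0, w)"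
  shows "common_level (s, V\<^sub>0, v) (t, W\<^sub>0, w) r \<longleftrightarrow> 0 < r \<and> int r \<in> snd ` (V \<inter> W)"
proof (cases "0 < r")
  case True
  have V\<^sub>0: "V\<^sub>0 = base_part V" and W\<^sub>0: "W\<^sub>0 = base_part W"
    using V(2) W(2) by (simp_all add: is_triple_def)
  let ?g = "geom_quot r s *s v" and ?h = "geom_quot r t *s w"
  have "?g - ?h \<in> V\<^sub>0 + W\<^sub>0 \<longleftrightarrow> (\<exists>a. a - ?g \<in> V\<^sub>0 \<and> a - ?h \<in> W\<^sub>0)"
  proof
    assume "?g - ?h \<in> V\<^sub>0 + W\<^sub>0"
    then obtain b c where "b \<in> V\<^sub>0" "c \<in> W\<^sub>0" "?g - ?h = b + c"
      by (rule set_plus_elim)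
    \<comment> \<open>The meeting point of the two cosets is \<open>?g - b\<close>, which equals
      \<open>?h + c\<close>.\<close>
    then have "(?g - b) - ?g \<in> V\<^sub>0" "(?g - b) - ?h \<in> W\<^sub>0"
      using base_part_minus[OF V(1)] by (simp_all add: V\<^sub>0 algebra_simps)
    then show "\<exists>a. a - ?g \<in> V\<^sub>0 \<and> a - ?h \<in> W\<^sub>0" by blast
  next
    assume "\<exists>a. a - ?g \<in> V\<^sub>0 \<and> a - ?h \<in> W\<^sub>0"
    then obtain a where "a - ?g \<in> V\<^sub>0" "a - ?h \<in> W\<^sub>0" by blast
    then have "- (a - ?g) + (a - ?h) \<in> V\<^sub>0 + W\<^sub>0"
      using base_part_minus[OF V(1)] by (intro set_plus_intro) (simp_all only: V\<^sub>0)
    then show "?g - ?h \<in> V\<^sub>0 + W\<^sub>0" by simp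
  qed
  moreover have "int r \<in> snd ` (V \<inter> W) \<longleftrightarrow> (\<exists>a. (a, int r) \<in> V \<and> (a, int r) \<in> W)"
    by force
  ultimately show ?thesis
    using True by (auto simp: common_level_def triple_fibre_iff[OF V] triple_fibre_iff[OF W])
qed (simp add: common_level_def)

lemma levels_add:
  assumes "subgroup U lamplighter" "j \<in> snd ` U" "k \<in> snd ` U"
  shows "j + k \<in> snd ` U"
  using assms(2,3) lamplighter_mult_closed[OF assms(1)] by force

lemma levels_minus:
  assumes "subgroup U lamplighter" "k \<in> snd ` U"
  shows "- k \<in> snd ` U"
  using assms(2) lamplighter_inv_closed[OF assms(1)] by force

text \<open>The multiplier may be negative, so the induction runs from 0 in both directions.\<close>

lemma levels_mult:
  assumes "subgroup U lamplighter" "k \<in> snd ` U"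
  shows "m * k \<in> snd ` U"
proof (induction m rule: int_induct[of _ 0])
  case base
  show ?case using lamplighter_one_closed[OF assms(1)] by force
next
  case (step1 i)
  have "(i + 1) * k = i * k + k" by (simp add: algebra_simps)
  with levels_add[OF assms(1) step1(2) assms(2)] show ?case by (simp only:)
next
  case (step2 i)
  have "(i - 1) * k = i * k + - k" by (simp add: algebra_simps)
  with levels_add[OF assms(1) step2(2) levels_minus[OF assms]] show ?case by (simp only:)
qed

text \<open>Division with remainder: the remainder of a level modulo \<open>r\<close> is again a
  level, and being smaller than \<open>r\<close> it must vanish.\<close>

lemma levels_eq_multiples:
  assumes "subgroup U lamplighter" "0 < r" "int r \<in> snd ` U"
    and least: "\<And>q. 0 < q \<Longrightarrow> int q \<in> snd ` U \<Longrightarrow> r \<le> q"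
  shows "snd ` U = {k. int r dvd k}"
proof (intro equalityI subsetI)
  fix k
  assume "k \<in> snd ` U"
  then have "k + (- (k div int r)) * int r \<in> snd ` U"
    using levels_add levels_mult assms(1,3) by blast
  then have "k mod int r \<in> snd ` U"
    by (simp add: minus_div_mult_eq_mod)
  moreover have "0 \<le> k mod int r" "k mod int r < int r"
    using assms(2) by simp_all
  ultimately have "k mod int r = 0"
    using least[of "nat (k mod int r)"] by force
  then show "k \<in> {k. int r dvd k}" by auto
next
  fix k
  assume "k \<in> {k. int r dvd k}"
  then show "k \<in> snd ` U"
    using levels_mult[OF assms(1,3)] by (auto simp: mult.commute elim!: dvdE)
qed

text \<open>Levels are closed under negation, so excluding positive ones excludes negative ones too
  and leaves only level 0.\<close>

lemma no_positive_level_imp_base: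
  assumes "subgroup U lamplighter" "\<And>q. 0 < q \<Longrightarrow> int q \<notin> snd ` U"
  shows "U = base_emb ` base_part U"
proof -
  have "k = 0" if "k \<in> snd ` U" for k
    using assms(2)[of "nat k"] assms(2)[of "nat (- k)"] that levels_minus[OF assms(1) that]
    by (cases k "0 :: int" rule: linorder_cases) auto
  then have "U \<subseteq> range base_emb"
    by (force simp: base_emb_def)
  then show ?thesis
    by (auto simp: base_emb_image_base_part)
qed

theorem corollary3p4:
  fixes V W U :: "(('p::prime_card, 'n::finite) base \<times> int) set"
    and V\<^sub>0 W\<^sub>0 :: "('p, 'n) base set" and v w :: "('p, 'n) base"
    and s t r :: nat
  assumes "subgroup V lamplighter" and "is_triple V (s, V\<^sub>0, v)"
    and "subgroup W lamplighter" and "is_triple W (t, W\<^sub>0, w)"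
    and "U = V \<inter> W"
    and "r = min_common_level (s, V\<^sub>0, v) (t, W\<^sub>0, w)"
  shows "(r = 0 \<longrightarrow> V \<inter> W = base_emb ` (V\<^sub>0 \<inter> W\<^sub>0))
    \<and> (r = 0 \<and> V\<^sub>0 \<inter> W\<^sub>0 = {0} \<longrightarrow> V \<inter> W = {\<one>\<^bsub>lamplighter\<^esub>})
    \<and> (r > 0 \<longrightarrow>
         (\<exists>v\<^sub>0\<in>V\<^sub>0. \<exists>w\<^sub>0\<in>W\<^sub>0. geom_quot r s *s v + v\<^sub>0 = geom_quot r t *s w + w\<^sub>0)
       \<and> (\<forall>v\<^sub>0\<in>V\<^sub>0. \<forall>w\<^sub>0\<in>W\<^sub>0. \<forall>u.
            u = geom_quot r s *s v + v\<^sub>0 \<and> u = geom_quot r t *s w + w\<^sub>0 \<longrightarrow>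
            subgroup U lamplighter \<and> is_triple U (r, V\<^sub>0 \<inter> W\<^sub>0, u)))"
proof -
  note V = assms(1,2) and W = assms(3,4)
  have V\<^sub>0: "V\<^sub>0 = base_part V" and W\<^sub>0: "W\<^sub>0 = base_part W"
    using V(2) W(2) by (simp_all add: is_triple_def)
  have U: "subgroup U lamplighter"
    unfolding assms(5) by (rule group.subgroups_Inter_pair[OF group_lamplighter V(1) W(1)])
  have U\<^sub>0: "base_part U = V\<^sub>0 \<inter> W\<^sub>0"
    by (simp add: assms(5) V\<^sub>0 W\<^sub>0 base_part_Int)
  let ?common = "common_level (s, V\<^sub>0, v) (t, W\<^sub>0, w)"
  have common: "?common q \<longleftrightarrow> 0 < q \<and> int q \<in> snd ` U" for q
    unfolding assms(5) by (rule common_level_iff[OF V W])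
  have common_r: "?common r" if "0 < r"
    using that LeastI_ex[of ?common] by (auto simp: assms(6) min_common_level_def split: if_splits)
  have least: "r \<le> q" if "?common q" for q
    using that Least_le[of ?common q] by (auto simp: assms(6) min_common_level_def)
  \<comment> \<open>Here \<open>r = 0\<close> can only be the default value: a least common level
    would itself be a common level, hence positive.\<close>
  have base: "V \<inter> W = base_emb ` (V\<^sub>0 \<inter> W\<^sub>0)" if "r = 0"
  proof -
    have "\<not> ?common q" for q
      using that LeastI_ex[of ?common] common[of 0]
      by (auto simp: assms(6) min_common_level_def split: if_splits)
    with common have "\<And>q. 0 < q \<Longrightarrow> int q \<notin> snd ` U" by blast
    from no_positive_level_imp_base[OF U this] show ?thesis
      by (simp add: U\<^sub>0 flip: assms(5))
  qed
  have witnesses: "\<exists>v\<^sub>0\<in>V\<^sub>0. \<exists>w\<^sub>0\<in>W\<^sub>0. geom_quot r s *s v + v\<^sub>0 = geom_quot r t *s w + w\<^sub>0"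
    if "0 < r"
  proof -
    from common_r[OF that] have "int r \<in> snd ` (V \<inter> W)"
      by (simp only: common assms(5))
    \<comment> \<open>The differences between this common point \<open>a\<close> and the two coset
      representatives serve as \<open>v\<^sub>0\<close> and \<open>w\<^sub>0\<close>.\<close>
    then obtain a where "(a, int r) \<in> V" "(a, int r) \<in> W" by force
    then have "a - geom_quot r s *s v \<in> V\<^sub>0" "a - geom_quot r t *s w \<in> W\<^sub>0"
      by (simp_all add: triple_fibre_iff[OF V that] triple_fibre_iff[OF W that])
    then show ?thesis by (intro bexI) (auto simp: algebra_simps)
  qed
  have triple: "is_triple U (r, V\<^sub>0 \<inter> W\<^sub>0, u)"
    if "0 < r" "v\<^sub>0 \<in> V\<^sub>0" "w\<^sub>0 \<in> W\<^sub>0"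
      "u = geom_quot r s *s v + v\<^sub>0" "u = geom_quot r t *s w + w\<^sub>0" for v\<^sub>0 w\<^sub>0 u
  proof -
    from common_r[OF that(1)] have "s dvd r" "t dvd r"
      by (simp_all add: common_level_def)
    from common_r[OF that(1)] have "int r \<in> snd ` U"
      by (simp only: common)
    \<comment> \<open>These differences are \<open>v\<^sub>0\<close> and \<open>w\<^sub>0\<close>,
      so \<open>u\<close> lies in both fibres over \<open>r\<close>.\<close>
    have "u - geom_quot r s *s v \<in> V\<^sub>0" "u - geom_quot r t *s w \<in> W\<^sub>0"
      using that(2,3) by (simp add: that(4), simp add: that(5))
    with \<open>s dvd r\<close> \<open>t dvd r\<close> have "(u, int r) \<in> U"
      by (simp add: assms(5) triple_fibre_iff[OF V that(1)] triple_fibre_iff[OF W that(1)])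
    \<comment> \<open>Common levels are exactly the positive levels of \<open>U\<close>, so
      \<open>r\<close> is the least of these and generates the projection.\<close>
    moreover have "snd ` U = {k. int r dvd k}"
      using levels_eq_multiples[OF U that(1) \<open>int r \<in> snd ` U\<close>] least common by blast
    ultimately show ?thesis
      using that(1) by (simp add: is_triple_def U\<^sub>0)
  qed
  have "base_emb ` {0} = {\<one>\<^bsub>lamplighter\<^esub>}"
    by (simp add: base_emb_def lamplighter_def)
  then have "V \<inter> W = {\<one>\<^bsub>lamplighter\<^esub>}" if "r = 0 \<and> V\<^sub>0 \<inter> W\<^sub>0 = {0}"
    using that base by simp
  with base witnesses triple U show ?thesis by blast
qed

end
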